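(* Let $N=\{1,\dots,n\}$ be a set of players and let $\mathbf{d}=(k_1,\dots,k_n)$ be a desired degree sequence for the $n$ players. Let $f:\mathbb{R}\to\mathbb{R}$ be a convex function with minimum at $0$, and assume that each Player $i$ wishes to maximize the objective $$Y_i(g) = -f_i(\eta_i(g)) = -f(\eta_i(g)-k_i),\qquad g\in G,$$ where $f_i(x)=f(x-k_i)$. Let $v$ be the balanced value function induced from the allocation rule $Y=(Y_1,\dots,Y_n)$, i.e. $v(g)=\sum_{i\in N}Y_i(g)$. If $\eta^{-1}(\mathbf{d})$ is non-empty (i.e. $\mathbf{d}$ is graphical), then any graph $g\in G$ such that $\eta(g)=\mathbf{d}$ is pairwise stable for the game $\mathcal{G}(v,Y,N)$.
   Context: A graph $g$ on the node set $N=\{1,\dots,n\}$ is a set of links, where a link $ij$ is a two-element subset $\{i,j\}$ of $N$; $G$ is the set of all such graphs. For $g\in G$, $g+ij$ is $g$ with the link $ij$ added and $g-ij$ is $g$ with the link $ij$ removed. $\eta_i(g)$ is the degree of node $i$ in $g$ and $\eta(g)=(\eta_1(g),\dots,\eta_n(g))$ is the degree sequence. A sequence $\mathbf{d}$ is graphical if there is a graph $g\in G$ with $\eta(g)=\mathbf{d}$, i.e. $\eta^{-1}(\mathbf{d})\neq\emptyset$. $Y_i(g)$ is the payoff allocated to player $i$ when the graph is $g$; $\mathcal{G}(v,Y,N)$ denotes the network formation game with value function $v$ and allocation rule $Y$ over the nodes $N$. A graph $g$ is pairwise stable (for this game) if and only if: (1) for all $ij\in g$, $Y_i(g)\ge Y_i(g-ij)$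 (for each of the two endpoints of the link); and (2) for all $ij\notin g$ (with $i\ne j$), if $Y_i(g+ij)>Y_i(g)$ then $Y_j(g+ij)<Y_j(g)$ (for each ordering of the two endpoints). *)

theory Defs
  imports "HOL-Analysis.Analysis"
begin

type_synonym graph = "nat set set"

definition nodes :: "nat \<Rightarrow> nat set" where
  "nodes n = {1..n}"

definition graphs :: "nat set \<Rightarrow> graph set" where
  "graphs N = Pow {{i, j} | i j. i \<in> N \<and> j \<in> N \<and> i \<noteq> j}"

definition add_link :: "graph \<Rightarrow> nat \<Rightarrow> nat \<Rightarrow> graph" where
  "add_link g i j = insert {i, j} g"

definition del_link :: "graph \<Rightarrow> nat \<Rightarrow> nat \<Rightarrow> graph" where
  "del_link g i j = g - {{i, j}}"

definition degree :: "graph \<Rightarrow> nat \<Rightarrow> nat" where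
  "degree g i = card {l \<in> g. i \<in> l}"

text \<open>Sequences indexed by the node set are functions that are \<open>undefined\<close> outside of it,
  so that \<open>=\<close> compares exactly the entries at the nodes.\<close>

definition degree_seq :: "nat set \<Rightarrow> graph \<Rightarrow> nat \<Rightarrow> nat" where
  "degree_seq N g = (\<lambda>i\<in>N. degree g i)"

definition graphical :: "nat set \<Rightarrow> (nat \<Rightarrow> nat) \<Rightarrow> bool" where
  "graphical N d \<longleftrightarrow> {g \<in> graphs N. degree_seq N g = d} \<noteq> {}"

datatype game =
  Game (val: "graph \<Rightarrow> real") (alloc: "nat \<Rightarrow> graph \<Rightarrow> real") (players: "nat set")

text \<open>The pairs \<open>(i, j)\<close> are ordered, so each condition is imposed for both
  endpoints of a link. The value function plays no role in stability.\<close>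

definition pairwise_stable :: "game \<Rightarrow> graph \<Rightarrow> bool" where
  "pairwise_stable \<Gamma> g \<longleftrightarrow>
     g \<in> graphs (players \<Gamma>) \<and>
     (\<forall>i\<in>players \<Gamma>. \<forall>j\<in>players \<Gamma>. {i, j} \<in> g \<longrightarrow>
        alloc \<Gamma> i g \<ge> alloc \<Gamma> i (del_link g i j)) \<and>
     (\<forall>i\<in>players \<Gamma>. \<forall>j\<in>players \<Gamma>. i \<noteq> j \<longrightarrow> {i, j} \<notin> g \<longrightarrow>
        alloc \<Gamma> i (add_link g i j) > alloc \<Gamma> i g \<longrightarrow>
        alloc \<Gamma> j (add_link g i j) < alloc \<Gamma> j g)"

end

theory Submission
  imports Defs
begin

text \<open>In a graph with the desired degree sequence every player has deviation \<open>0\<close>, hence the payoff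
  \<open>- f 0\<close>, and as \<open>f\<close> has its minimum at \<open>0\<close> no graph pays that player more. Such a graph is the
  favourite of all players simultaneously, so neither cutting nor adding a link can benefit anybody
  (\<open>pairwise_stable_if_unanimously_optimal\<close>).\<close>

lemma del_link_in_graphs: "g \<in> graphs N \<Longrightarrow> del_link g i j \<in> graphs N"
  by (auto simp: graphs_def del_link_def)

lemma add_link_in_graphs:
  "g \<in> graphs N \<Longrightarrow> i \<in> N \<Longrightarrow> j \<in> N \<Longrightarrow> i \<noteq> j \<Longrightarrow> add_link g i j \<in> graphs N"
  by (auto simp: graphs_def add_link_def)

text \<open>Both conditions of stability compare \<open>g\<close> with other graphs on the same nodes: optimality gives
  the first one directly, and makes the second one vacuous, as no added link is a strict gain.\<close>

lemma pairwise_stable_if_unanimously_optimal: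
  assumes "g \<in> graphs N"
    and "\<And>i h. i \<in> N \<Longrightarrow> h \<in> graphs N \<Longrightarrow> Y i h \<le> Y i g"
  shows "pairwise_stable (Game v Y N) g"
  using assms
  by (auto simp: pairwise_stable_def del_link_in_graphs add_link_in_graphs simp flip: not_le)

theorem theorem3p1:
  fixes n :: nat
    and N :: "nat set"
    and k d :: "nat \<Rightarrow> nat"
    and f :: "real \<Rightarrow> real"
    and Y :: "nat \<Rightarrow> graph \<Rightarrow> real"
    and v :: "graph \<Rightarrow> real"
  assumes "N = nodes n"
    and "d = (\<lambda>i\<in>N. k i)"
    and "convex_on UNIV f"
    and "\<And>x. f 0 \<le> f x"
    and "\<And>i g. i \<in> N \<Longrightarrow> g \<in> graphs N \<Longrightarrow> Y i g = - f (real (degree g i) - real (k i))"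
    and "\<And>g. g \<in> graphs N \<Longrightarrow> v g = (\<Sum>i\<in>N. Y i g)"
    and "graphical N d"
  shows "\<forall>g\<in>graphs N. degree_seq N g = d \<longrightarrow> pairwise_stable (Game v Y N) g"
proof (intro ballI impI)
  fix g assume g: "g \<in> graphs N" and deg: "degree_seq N g = d"
  have "Y i h \<le> Y i g" if i: "i \<in> N" and h: "h \<in> graphs N" for i h
  proof -
    have "degree g i = k i"
      using fun_cong[OF deg, of i] i assms(2) by (simp add: degree_seq_def)
    then have "Y i g = - f 0"
      using assms(5)[OF i g] by simp
    then show ?thesis
      using assms(5)[OF i h] assms(4) by simp
  qed
  with g show "pairwise_stable (Game v Y N) g"
    by (rule pairwise_stable_if_unanimously_optimal)
qed

end
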